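(* Let $q$ be a prime power, $t\ge 1$, $\mathbb{B}=\mathrm{GF}(q)$, $\mathbb{F}=\mathrm{GF}(q^t)$, $n=q^t$, and let $1\le k\le n-q^{t-1}$. Then, for the full-length Reed-Solomon code $\mathrm{RS}(\mathbb{F},k)$ with the symbol $c(0)$ erased, there is a trace-repair scheme that repairs $c(0)$ with bandwidth at most $k\log_2|\mathbb{F}|$ bits.
   Context: $\mathrm{RS}(\mathbb{F},k)=\{(c(\alpha))_{\alpha\in\mathbb{F}} : c\in\mathbb{F}[x],\ \deg c\le k-1\}$; each surviving node $\alpha\in\mathbb{F}\setminus\{0\}$ stores $c(\alpha)$. $\mathrm{Tr}:\mathbb{F}\to\mathbb{B}$ is the field trace. A trace-repair scheme for $c(0)$ consists of a set $\mathcal{H}\subseteq\mathbb{F}\setminus\{0\}$ of helper nodes and elements $\gamma_\alpha\in\mathbb{F}$ ($\alpha\in\mathcal{H}$), depending only on the code and not on the codeword, such that for every $c\in\mathbb{F}[x]$ with $\deg c\le k-1$ the value $c(0)$ is uniquely determined by the traces $\mathrm{Tr}(\gamma_\alpha c(\alpha))\in\mathbb{B}$, $\alpha\in\mathcal{H}$. So each helper node sends exactly one element of $\mathbb{B}$, and the bandwidth of the scheme is $|\mathcal{H}|\log_2|\mathbb{B}|$ bits. *)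

theory Defs
  imports
    "HOL-Computational_Algebra.Computational_Algebra"
    "HOL-Number_Theory.Prime_Powers"
    Complex_Main
begin

definition is_subfield :: "'f::field set \<Rightarrow> bool" where
  "is_subfield B \<longleftrightarrow> 0 \<in> B \<and> 1 \<in> B \<and>
     (\<forall>x\<in>B. \<forall>y\<in>B. x - y \<in> B \<and> x * y \<in> B) \<and> (\<forall>x\<in>B. inverse x \<in> B)"

text \<open>
  The trace of \<open>GF(q^t)\<close> over its subfield \<open>GF(q)\<close>: the sum of the \<open>t\<close> conjugates of
  \<open>x\<close> under the Frobenius automorphism \<open>x \<mapsto> x ^ q\<close>. It is typed as an element of the
  large field; that it lies in the subfield is \<open>field_trace_in_subfield\<close> below.
\<close>

definition field_trace :: "nat \<Rightarrow> nat \<Rightarrow> 'f::field \<Rightarrow> 'f" where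
  "field_trace q t x = (\<Sum>i<t. x ^ (q ^ i))"

text \<open>Codewords are indexed by all field elements. The truncated \<open>k - 1\<close> is only meant for
  \<open>k \<ge> 1\<close>.\<close>

definition rs_code :: "nat \<Rightarrow> ('f::finite_field \<Rightarrow> 'f) set" where
  "rs_code k = {poly c | c. degree c \<le> k - 1}"

text \<open>
  The erased symbol is \<open>w 0\<close>. Unique determination by the transmitted traces means that two
  codewords with the same traces agree at \<open>0\<close>. Values of \<open>\<gamma>\<close> outside \<open>H\<close> are irrelevant.
\<close>

definition trace_repair_scheme ::
    "nat \<Rightarrow> nat \<Rightarrow> nat \<Rightarrow> 'f::finite_field set \<Rightarrow> ('f \<Rightarrow> 'f) \<Rightarrow> bool" where
  "trace_repair_scheme q t k H \<gamma> \<longleftrightarrow> H \<subseteq> UNIV - {0} \<and>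
     (\<forall>w\<in>rs_code k. \<forall>w'\<in>rs_code k.
        (\<forall>\<alpha>\<in>H. field_trace q t (\<gamma> \<alpha> * w \<alpha>) = field_trace q t (\<gamma> \<alpha> * w' \<alpha>)) \<longrightarrow> w 0 = w' 0)"

text \<open>In bits, one element of \<open>B\<close> being sent by each helper node in \<open>H\<close>.\<close>

definition bandwidth :: "'f set \<Rightarrow> 'f set \<Rightarrow> real" where
  "bandwidth B H = real (card H) * log 2 (real (card B))"

lemma subfield_eq_frobenius_fixed:
  fixes B :: "'f::finite_field set"
  assumes "is_subfield B"
  shows "B = {x. x ^ card B = x}"
proof (rule card_subset_eq)
  have B: "0 \<in> B" "1 \<in> B" "\<And>x y. x \<in> B \<Longrightarrow> y \<in> B \<Longrightarrow> x * y \<in> B"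
    "\<And>x. x \<in> B \<Longrightarrow> inverse x \<in> B"
    using assms by (auto simp: is_subfield_def)
  have c2: "card B \<ge> 2"
    using card_mono[of B "{0, 1}"] B by auto
  show sub: "B \<subseteq> {x. x ^ card B = x}"
  proof
    fix x assume x: "x \<in> B"
    show "x \<in> {x. x ^ card B = x}"
    proof (cases "x = 0")
      case True
      then show ?thesis using c2 by (cases "card B") auto
    next
      case False
      have "(\<Prod>y\<in>B-{0}. y) = (\<Prod>y\<in>B-{0}. x * y)"
        by (rule prod.reindex_bij_witness[of _ "\<lambda>y. x * y" "\<lambda>y. inverse x * y"])
           (use False x B in auto)
      also have "\<dots> = x ^ (card B - 1) * (\<Prod>y\<in>B-{0}. y)"
        using B by (simp add: prod.distrib)
      finally have "x ^ (card B - 1) = 1"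
        by simp
      then have "x ^ Suc (card B - 1) = x"
        by simp
      then show ?thesis using c2 by simp
    qed
  qed
  let ?p = "monom 1 (card B) - [:0, 1:] :: 'f poly"
  have "coeff ?p (card B) = 1"
    using c2 by (simp add: coeff_pCons split: nat.splits)
  then have p0: "?p \<noteq> 0"
    by (metis coeff_0 zero_neq_one)
  have "degree ?p \<le> card B"
    by (rule degree_diff_le) (use c2 in \<open>auto simp: degree_monom_eq\<close>)
  moreover have "{x. x ^ card B = x} = {x. poly ?p x = 0}"
    by (auto simp: poly_monom)
  ultimately have "card {x::'f. x ^ card B = x} \<le> card B"
    using card_poly_roots_bound[OF p0] by simp
  then show "card B = card {x::'f. x ^ card B = x}"
    using card_mono[OF _ sub] by simp
qed simp

lemma field_trace_in_subfield:
  fixes B :: "'f::finite_field set"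
  assumes "primepow q" "t \<ge> 1" "card (UNIV :: 'f set) = q ^ t" "is_subfield B" "card B = q"
  shows "field_trace q t (x :: 'f) \<in> B"
proof -
  obtain p m where p: "prime p" "m > 0" "q = p ^ m"
    using assms(1) by (auto simp: primepow_def)
  have "(\<Sum>y\<in>UNIV. y + 1 :: 'f) = (\<Sum>y\<in>UNIV. y)"
    by (rule sum.reindex_bij_witness[of _ "\<lambda>y. y - 1" "\<lambda>y. y + 1"]) auto
  then have "of_nat (card (UNIV :: 'f set)) = (0 :: 'f)"
    by (simp add: sum.distrib)
  then have "CHAR('f) dvd q ^ t"
    using assms(3) by (simp only: of_nat_eq_0_iff_char_dvd)
  then have "CHAR('f) dvd p ^ (m * t)"
    by (simp add: p power_mult)
  then have ch: "CHAR('f) = p"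
    using p(1) prime_dvd_power[OF prime_CHAR_semidom[where 'a = 'f]]
    by (metis CHAR_pos prime_CHAR_semidom prime_dvd_power primes_dvd_imp_eq)
  have "field_trace q t x ^ q = (\<Sum>i<t. (x ^ q ^ i) ^ q)"
    unfolding field_trace_def
    by (subst freshmans_dream_sum'[where n = m]) (use ch p in auto)
  also have "\<dots> = (\<Sum>i<t. x ^ q ^ Suc i)"
    by (simp add: mult.commute flip: power_mult)
  also have "\<dots> = field_trace q t x"
  proof -
    have "(\<Sum>i<t. x ^ q ^ Suc i) + x ^ q ^ 0 = (\<Sum>i<t. x ^ q ^ i) + x ^ q ^ t"
      using sum.lessThan_Suc_shift[of "\<lambda>i. x ^ q ^ i" t] by (simp add: add.commute)
    moreover have "x ^ q ^ t = x"
      using finite_field_power_card_eq_same[of x] assms(3) by simp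
    ultimately show ?thesis by (simp add: field_trace_def)
  qed
  finally show ?thesis
    using subfield_eq_frobenius_fixed[OF assms(4)] assms(5) by blast
qed

end

theory Submission
  imports Defs
begin

text \<open>
  Guruswami and Wootters use all nonzero nodes with \<open>\<gamma> \<alpha> = 1 / \<alpha>\<close>. For \<open>\<mu>\<close> in the field,
  \<open>Tr (\<mu> x) / x\<close> is a polynomial of degree \<open>q ^ (t - 1) - 1\<close> with value \<open>\<mu>\<close> at \<open>0\<close>; its product
  with a message polynomial has degree less than \<open>n - 1\<close>, so it sums to \<open>0\<close> over the field. Hence
  \<open>\<mu> c(0) = - (\<Sum>\<alpha>\<noteq>0. Tr (\<mu> \<alpha>) (c(\<alpha>) / \<alpha>))\<close>, and applying \<open>Tr\<close> expresses every \<open>Tr (\<mu> c(0))\<close>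
  through the traces of the \<open>c(\<alpha>) / \<alpha>\<close>. These are \<open>B\<close>-linear functionals on the code, and for
  a minimal set \<open>H\<close> of nodes on which their vanishing implies that all of them vanish there are
  codewords dual to the functionals of \<open>H\<close>. Combining these with coefficients from \<open>B\<close> embeds
  \<open>B ^ H\<close> into the code, so \<open>|B| ^ |H| \<le> n ^ k\<close>.
\<close>

section \<open>Power sums over a finite field\<close>

lemma of_nat_card_UNIV_eq_0: "of_nat (card (UNIV :: 'f::finite_field set)) = (0 :: 'f)"
proof -
  \<comment> \<open>Translation by 1 permutes the field, so adding \<open>card UNIV\<close> copies
    of 1 leaves the total unchanged.\<close>
  have "(\<Sum>y\<in>UNIV. y + 1 :: 'f) = (\<Sum>y\<in>UNIV. y)"
    by (rule sum.reindex_bij_witness[of _ "\<lambda>y. y - 1" "\<lambda>y. y + 1"]) auto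
  then show ?thesis
    by (simp add: sum.distrib)
qed

text \<open>Multiplication by a nonzero \<open>a\<close> permutes the field, so the power sum is
  invariant under the factor \<open>a ^ j\<close>. Since \<open>x ^ j - 1\<close> has at most
  \<open>j\<close> roots, some \<open>a \<noteq> 0\<close> has \<open>a ^ j \<noteq> 1\<close>, and
  the sum must vanish.\<close>

lemma sum_power_UNIV_eq_0:
  assumes "j < card (UNIV :: 'f::finite_field set) - 1"
  shows "(\<Sum>x\<in>UNIV. x ^ j :: 'f) = 0"
proof (cases "j = 0")
  case True
  then show ?thesis
    by (simp add: of_nat_card_UNIV_eq_0)
next
  case False
  let ?p = "monom 1 j - 1 :: 'f poly"
  have "coeff ?p j = 1"
    using False by simp
  then have p0: "?p \<noteq> 0"
    by (metis coeff_0 zero_neq_one)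
  have "degree ?p \<le> j"
    by (rule degree_diff_le) (auto simp: degree_monom_eq)
  then have "card {x. poly ?p x = 0} \<le> j"
    using card_poly_roots_bound[OF p0] by simp
  then have "\<not> UNIV - {0} \<subseteq> {x. poly ?p x = 0}"
    using card_mono[of "{x. poly ?p x = 0}" "UNIV - {0}"] assms by auto
  then obtain a :: 'f where a: "a \<noteq> 0" "a ^ j \<noteq> 1"
    by (auto simp: poly_monom)
  have "(\<Sum>x\<in>UNIV. x ^ j) = (\<Sum>x\<in>UNIV. (a * x) ^ j)"
    by (rule sum.reindex_bij_witness[of _ "\<lambda>x. a * x" "\<lambda>x. x / a"]) (use a in auto)
  also have "\<dots> = a ^ j * (\<Sum>x\<in>UNIV. x ^ j)"
    by (simp add: power_mult_distrib sum_distrib_left)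
  finally show ?thesis
    using a by simp
qed

lemma sum_poly_UNIV_eq_0:
  assumes "degree p < card (UNIV :: 'f::finite_field set) - 1"
  shows "(\<Sum>x\<in>UNIV. poly p x :: 'f) = 0"
proof -
  have "(\<Sum>x\<in>UNIV. poly p x) = (\<Sum>i\<le>degree p. coeff p i * (\<Sum>x\<in>UNIV. x ^ i))"
    unfolding poly_altdef sum_distrib_left by (rule sum.swap)
  also have "\<dots> = 0"
    by (rule sum.neutral) (use assms in \<open>auto intro!: sum_power_UNIV_eq_0\<close>)
  finally show ?thesis .
qed

section \<open>Size and closure properties of the code\<close>

lemma card_rs_code_le:
  assumes "k \<ge> 1"
  shows "card (rs_code k :: ('f::finite_field \<Rightarrow> 'f) set) \<le> card (UNIV :: 'f set) ^ k"
proof -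
  let ?e = "\<lambda>a x :: 'f. \<Sum>i<k. a i * x ^ i"
  have "rs_code k \<subseteq> ?e ` ({..<k} \<rightarrow>\<^sub>E UNIV)"
  proof
    fix w :: "'f \<Rightarrow> 'f" assume "w \<in> rs_code k"
    then obtain c where c: "w = poly c" "degree c \<le> k - 1"
      by (auto simp: rs_code_def)
    \<comment> \<open>Coefficients between \<open>degree c\<close> and \<open>k - 1\<close> vanish;
      \<open>k \<ge> 1\<close> makes \<open>{..k - 1}\<close> the same range as
      \<open>{..<k}\<close>.\<close>
    have "poly c x = ?e (restrict (coeff c) {..<k}) x" for x
      unfolding poly_altdef
      by (rule sum.mono_neutral_cong_left) (use c(2) assms in \<open>auto simp: coeff_eq_0\<close>)
    then show "w \<in> ?e ` ({..<k} \<rightarrow>\<^sub>E UNIV)"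
      using c(1) by (intro image_eqI[of _ _ "restrict (coeff c) {..<k}"]) auto
  qed
  then have "card (rs_code k :: ('f \<Rightarrow> 'f) set) \<le> card ({..<k} \<rightarrow>\<^sub>E (UNIV :: 'f set))"
    by (rule surj_card_le[rotated]) (simp add: finite_PiE)
  then show ?thesis
    by (simp add: card_PiE)
qed

lemma rs_code_zero: "(\<lambda>x. 0) \<in> rs_code k"
  by (auto simp: rs_code_def intro!: exI[of _ 0])

lemma rs_code_add:
  assumes "w \<in> rs_code k" "w' \<in> rs_code k"
  shows "(\<lambda>x. w x + w' x) \<in> rs_code k"
proof -
  obtain c c' where "w = poly c" "degree c \<le> k - 1" "w' = poly c'" "degree c' \<le> k - 1"
    using assms by (auto simp: rs_code_def)
  then show ?thesis
    by (auto simp: rs_code_def degree_add_le intro!: exI[of _ "c + c'"])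
qed

lemma rs_code_scale:
  assumes "w \<in> rs_code k"
  shows "(\<lambda>x. b * w x) \<in> rs_code k"
proof -
  obtain c where "w = poly c" "degree c \<le> k - 1"
    using assms by (auto simp: rs_code_def)
  then show ?thesis
    using degree_smult_le[of b c] by (auto simp: rs_code_def intro!: exI[of _ "smult b c"])
qed

section \<open>Functionals linear over the subfield\<close>

lemma linear_functional_combination:
  fixes V :: "('b \<Rightarrow> 'f::field) set"
  assumes zero: "(\<lambda>x. 0) \<in> V"
    and add: "\<And>v w. v \<in> V \<Longrightarrow> w \<in> V \<Longrightarrow> (\<lambda>x. v x + w x) \<in> V"
    and scale: "\<And>b v. b \<in> B \<Longrightarrow> v \<in> V \<Longrightarrow> (\<lambda>x. b * v x) \<in> V"
    and L_zero: "L (\<lambda>x. 0) = 0"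
    and L_add: "\<And>v w. v \<in> V \<Longrightarrow> w \<in> V \<Longrightarrow> L (\<lambda>x. v x + w x) = L v + L w"
    and L_scale: "\<And>b v. b \<in> B \<Longrightarrow> v \<in> V \<Longrightarrow> L (\<lambda>x. b * v x) = b * L v"
    and "finite A" "\<And>a. a \<in> A \<Longrightarrow> g a \<in> B" "\<And>a. a \<in> A \<Longrightarrow> u a \<in> V"
  shows "(\<lambda>x. \<Sum>a\<in>A. g a * u a x) \<in> V \<and> L (\<lambda>x. \<Sum>a\<in>A. g a * u a x) = (\<Sum>a\<in>A. g a * L (u a))"
  using assms(7-9)
proof (induction A rule: finite_induct)
  case empty
  then show ?case
    by (simp add: zero L_zero)
next
  case (insert a A)
  then show ?case
    by (simp add: add scale L_add L_scale)
qed

text \<open>A counting form of the bound of the rank of a family of functionals by the dimension of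
  the space: \<open>card V\<close> stands in for the dimension over \<open>B\<close>.\<close>

lemma spanning_functionals_subset:
  fixes V :: "('b \<Rightarrow> 'f::finite_field) set" and L :: "'a \<Rightarrow> ('b \<Rightarrow> 'f) \<Rightarrow> 'f"
  assumes B: "is_subfield B" and finV: "finite V" and finA: "finite A"
    and zero: "(\<lambda>x. 0) \<in> V"
    and add: "\<And>v w. v \<in> V \<Longrightarrow> w \<in> V \<Longrightarrow> (\<lambda>x. v x + w x) \<in> V"
    and scale: "\<And>b v. b \<in> B \<Longrightarrow> v \<in> V \<Longrightarrow> (\<lambda>x. b * v x) \<in> V"
    and L_zero: "\<And>a. L a (\<lambda>x. 0) = 0"
    and L_add: "\<And>a v w. v \<in> V \<Longrightarrow> w \<in> V \<Longrightarrow> L a (\<lambda>x. v x + w x) = L a v + L a w"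
    and L_scale: "\<And>a b v. b \<in> B \<Longrightarrow> v \<in> V \<Longrightarrow> L a (\<lambda>x. b * v x) = b * L a v"
    and L_in: "\<And>a v. v \<in> V \<Longrightarrow> L a v \<in> B"
  shows "\<exists>H\<subseteq>A. card B ^ card H \<le> card V \<and>
    (\<forall>v\<in>V. (\<forall>a\<in>H. L a v = 0) \<longrightarrow> (\<forall>a\<in>A. L a v = 0))"
proof -
  define P where
    "P H \<longleftrightarrow> H \<subseteq> A \<and> (\<forall>v\<in>V. (\<forall>a\<in>H. L a v = 0) \<longrightarrow> (\<forall>a\<in>A. L a v = 0))" for H
  have "P A"
    by (auto simp: P_def)
  then obtain H where H: "P H" and minimal: "\<And>H'. P H' \<Longrightarrow> card H \<le> card H'"
    using ex_has_least_nat[of P A card] by blast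
  have HA: "H \<subseteq> A" and finH: "finite H"
    using H finA finite_subset by (auto simp: P_def)
  have dual: "\<exists>v\<in>V. L a v = 1 \<and> (\<forall>a'\<in>H - {a}. L a' v = 0)" if "a \<in> H" for a
  proof -
    \<comment> \<open>Minimality acts as linear independence: some \<open>v\<close> is killed by the
      functionals of \<open>H - {a}\<close> but not by all of \<open>A\<close>. Were
      \<open>L a v\<close> zero too, \<open>H\<close> itself would fail to span.\<close>
    have "\<not> P (H - {a})"
      using minimal[of "H - {a}"] card_Diff1_less[OF finH that] by auto
    then obtain v where v: "v \<in> V" "\<forall>a'\<in>H - {a}. L a' v = 0" "\<exists>a'\<in>A. L a' v \<noteq> 0"
      using HA by (auto simp: P_def)
    have "L a v \<noteq> 0"
    proof
      assume "L a v = 0"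
      then have "\<forall>a'\<in>H. L a' v = 0"
        using v(2) by auto
      then show False
        using H v(1,3) unfolding P_def by blast
    qed
    \<comment> \<open>\<open>L\<close> takes values in \<open>B\<close>, so normalising to
      \<open>L a v = 1\<close> uses an admissible scalar.\<close>
    moreover have "inverse (L a v) \<in> B"
      using B L_in[OF v(1)] by (simp add: is_subfield_def)
    ultimately show ?thesis
      using v by (intro bexI[of _ "\<lambda>x. inverse (L a v) * v x"]) (auto simp: L_scale scale)
  qed
  then obtain u where u: "\<And>a. a \<in> H \<Longrightarrow> u a \<in> V" "\<And>a. a \<in> H \<Longrightarrow> L a (u a) = 1"
      "\<And>a a'. a \<in> H \<Longrightarrow> a' \<in> H - {a} \<Longrightarrow> L a' (u a) = 0"
    by metis
  let ?c = "\<lambda>g x. \<Sum>a\<in>H. g a * u a x"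
  have comb: "?c g \<in> V \<and> L a (?c g) = (\<Sum>a'\<in>H. g a' * L a (u a'))"
    if "g \<in> H \<rightarrow>\<^sub>E B" for g a
    by (rule linear_functional_combination[OF zero add scale L_zero L_add L_scale finH])
      (use that u(1) in auto)
  have coord: "L a (?c g) = g a" if g: "g \<in> H \<rightarrow>\<^sub>E B" and a: "a \<in> H" for g a
  proof -
    have "L a (?c g) = (\<Sum>a'\<in>H. if a' = a then g a' else 0)"
      unfolding comb[OF g, THEN conjunct2] by (rule sum.cong) (use a u in auto)
    then show ?thesis
      using a finH by simp
  qed
  \<comment> \<open>By duality, \<open>L a\<close> reads the coefficient \<open>g a\<close> off the
    combination.\<close>
  have "inj_on ?c (H \<rightarrow>\<^sub>E B)"
  proof (rule inj_onI)
    fix g g' assume g: "g \<in> H \<rightarrow>\<^sub>E B" and g': "g' \<in> H \<rightarrow>\<^sub>E B" and eq: "?c g = ?c g'"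
    show "g = g'"
    proof (rule PiE_ext[OF g g'])
      fix a assume a: "a \<in> H"
      show "g a = g' a"
        unfolding coord[OF g a, symmetric] coord[OF g' a, symmetric] eq ..
    qed
  qed
  moreover have "?c ` (H \<rightarrow>\<^sub>E B) \<subseteq> V"
    using comb by blast
  ultimately have "card (H \<rightarrow>\<^sub>E B) \<le> card V"
    using card_inj_on_le finV by blast
  then have "card B ^ card H \<le> card V"
    using finH by (simp add: card_PiE)
  then show ?thesis
    using H by (auto simp: P_def)
qed

section \<open>The trace quotient polynomial and nondegeneracy of the trace\<close>

definition trace_quotient_poly :: "nat \<Rightarrow> nat \<Rightarrow> 'f::field \<Rightarrow> 'f poly" where
  "trace_quotient_poly q t \<mu> = (\<Sum>i<t. monom (\<mu> ^ (q ^ i)) (q ^ i - 1))"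

lemma poly_trace_quotient:
  assumes "q > 0"
  shows "x * poly (trace_quotient_poly q t \<mu>) x = field_trace q t (\<mu> * x)"
  unfolding trace_quotient_poly_def field_trace_def poly_sum poly_monom sum_distrib_left
proof (rule sum.cong)
  fix i
  have "x ^ (q ^ i - 1) * x = x ^ q ^ i"
    using assms by (intro power_minus_mult) simp
  then show "x * (\<mu> ^ q ^ i * x ^ (q ^ i - 1)) = (\<mu> * x) ^ q ^ i"
    by (simp add: power_mult_distrib mult_ac)
qed simp

lemma poly_trace_quotient_0:
  assumes "q > 1" "t \<ge> 1"
  shows "poly (trace_quotient_poly q t \<mu>) 0 = \<mu>"
proof -
  have "poly (trace_quotient_poly q t \<mu>) 0 = (\<Sum>i<t. if i = 0 then \<mu> else 0)"
    unfolding trace_quotient_poly_def poly_sum poly_monom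
  proof (rule sum.cong)
    fix i
    \<comment> \<open>Only the summand \<open>i = 0\<close> has exponent 0, where
      \<open>0 ^ 0 = 1\<close> leaves \<mu>.\<close>
    have "q ^ i - 1 > 0" if "i > 0"
      using one_less_power[OF assms(1) that] by simp
    then show "\<mu> ^ q ^ i * 0 ^ (q ^ i - 1) = (if i = 0 then \<mu> else 0)"
      by auto
  qed simp
  then show ?thesis
    using assms(2) by simp
qed

lemma degree_trace_quotient_poly:
  assumes "q > 0"
  shows "degree (trace_quotient_poly q t \<mu>) \<le> q ^ (t - 1) - 1"
  unfolding trace_quotient_poly_def
proof (rule degree_sum_le)
  fix i assume "i \<in> {..<t}"
  then have "q ^ i \<le> q ^ (t - 1)"
    using assms by (intro power_increasing) auto
  then show "degree (monom (\<mu> ^ q ^ i) (q ^ i - 1)) \<le> q ^ (t - 1) - 1"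
    using degree_monom_le[of "\<mu> ^ q ^ i" "q ^ i - 1"] by linarith
qed simp

text \<open>Otherwise the trace quotient polynomial of \<open>y\<close> is nonzero, as its value at
  0 is \<open>y\<close>, yet vanishes at all \<open>q ^ t - 1\<close> nonzero points, more than its
  degree allows.\<close>

lemma field_trace_nondegenerate:
  fixes y :: "'f::finite_field"
  assumes "q > 1" "t \<ge> 1" "card (UNIV :: 'f set) = q ^ t"
    and "\<And>\<mu>. field_trace q t (\<mu> * y) = 0"
  shows "y = 0"
proof (rule ccontr)
  assume "y \<noteq> 0"
  let ?p = "trace_quotient_poly q t y"
  have p0: "?p \<noteq> 0"
    using poly_trace_quotient_0[OF assms(1,2), of y] \<open>y \<noteq> 0\<close> by auto
  have "x * poly ?p x = 0" for x
    using poly_trace_quotient[of q x t y] assms(1,4) by (simp add: mult.commute)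
  then have "UNIV - {0} \<subseteq> {x. poly ?p x = 0}"
    by auto
  then have "card (UNIV :: 'f set) - 1 \<le> card {x. poly ?p x = 0}"
    using card_mono[of "{x. poly ?p x = 0}" "UNIV - {0}"] by simp
  also have "\<dots> \<le> q ^ (t - 1) - 1"
    using card_poly_roots_bound[OF p0] degree_trace_quotient_poly[of q t y] assms(1) by simp
  finally have "q ^ t - 1 \<le> q ^ (t - 1) - 1"
    using assms(3) by simp
  \<comment> \<open>Positivity lets the truncated \<open>- 1\<close> be cancelled on both
    sides.\<close>
  moreover have "q ^ (t - 1) > 0"
    using assms(1) by simp
  ultimately have "q ^ t \<le> q ^ (t - 1)"
    by linarith
  then show False
    using assms(1,2) power_strict_increasing[of "t - 1" t q] by linarith
qed

section \<open>Linearity of the trace and repair of the erased symbol\<close>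

context
  fixes q t :: nat and B :: "'f::finite_field set"
  assumes q: "primepow q" and card_field: "card (UNIV :: 'f set) = q ^ t"
    and B: "is_subfield B" "card B = q"
begin

text \<open>The characteristic is a prime dividing \<open>q ^ t\<close>, hence the prime underlying
  \<open>q\<close>. This makes each \<open>x \<mapsto> x ^ q ^ i\<close> additive.\<close>

lemma q_power_CHAR: obtains m where "q = CHAR('f) ^ m"
proof -
  obtain p m where p: "prime p" "q = p ^ m"
    using q by (auto simp: primepow_def)
  have "CHAR('f) dvd q ^ t"
    using of_nat_card_UNIV_eq_0[where 'f = 'f] card_field by (simp only: of_nat_eq_0_iff_char_dvd)
  then have "CHAR('f) dvd p ^ (m * t)"
    by (simp add: p power_mult)
  then have "CHAR('f) = p"
    using p(1) by (metis CHAR_pos prime_CHAR_semidom prime_dvd_power primes_dvd_imp_eq)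
  then show thesis
    using that p(2) by blast
qed

lemma field_trace_zero: "field_trace q t (0 :: 'f) = 0"
  using primepow_gt_0_nat[OF q] by (auto simp: field_trace_def intro!: sum.neutral)

lemma field_trace_add: "field_trace q t (x + y :: 'f) = field_trace q t x + field_trace q t y"
proof -
  obtain m where m: "q = CHAR('f) ^ m"
    using q_power_CHAR .
  have "(x + y) ^ q ^ i = x ^ q ^ i + y ^ q ^ i" for i
    by (rule freshmans_dream'[where n = "m * i"]) (simp_all add: m power_mult)
  then show ?thesis
    by (simp add: field_trace_def sum.distrib)
qed

lemma field_trace_sum:
  "field_trace q t (\<Sum>a\<in>A. f a :: 'f) = (\<Sum>a\<in>A. field_trace q t (f a))"
  by (induction A rule: infinite_finite_induct) (simp_all add: field_trace_zero field_trace_add)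

text \<open>Elements of \<open>B\<close> are fixed by \<open>x \<mapsto> x ^ q\<close>, hence by all
  its iterates.\<close>

lemma field_trace_scale:
  assumes "b \<in> B"
  shows "field_trace q t (b * x :: 'f) = b * field_trace q t x"
proof -
  have bq: "b ^ q = b"
    using subfield_eq_frobenius_fixed[OF B(1)] assms B(2) by blast
  have "b ^ q ^ i = b" for i
    by (induction i) (simp_all add: bq power_mult)
  then show ?thesis
    by (simp add: field_trace_def power_mult_distrib sum_distrib_left)
qed

text \<open>The kernel form of repair from all nonzero nodes; by linearity it is applied later to
  the difference of two codewords.\<close>

lemma rs_code_symbol_repair:
  assumes "t \<ge> 1" "1 \<le> k" "k \<le> q ^ t - q ^ (t - 1)" "w \<in> rs_code k"
    and traces: "\<And>\<alpha>. \<alpha> \<noteq> 0 \<Longrightarrow> field_trace q t (1 / \<alpha> * w \<alpha>) = 0"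
  shows "w (0 :: 'f) = 0"
proof (rule field_trace_nondegenerate)
  show q1: "q > 1"
    using primepow_gt_Suc_0[OF q] by simp
  obtain c where c: "w = poly c" "degree c \<le> k - 1"
    using assms by (auto simp: rs_code_def)
  fix \<mu> :: 'f
  let ?p = "trace_quotient_poly q t \<mu>"
  have "degree (?p * c) \<le> degree ?p + degree c"
    by (rule degree_mult_le)
  also have "\<dots> \<le> (q ^ (t - 1) - 1) + (k - 1)"
    using degree_trace_quotient_poly[of q t \<mu>] c(2) q1 by (intro add_mono) auto
  \<comment> \<open>The rate condition enters here: the degree is at most
    \<open>q ^ (t - 1) + k - 2 \<le> q ^ t - 2\<close>, just below the first exponent not covered by
    the power sum lemma.\<close>
  also have "\<dots> < q ^ t - 1"
  proof -
    have "q ^ (t - 1) > 0"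
      using q1 by simp
    then show ?thesis
      using assms(2,3) by linarith
  qed
  finally have "(\<Sum>x\<in>UNIV. poly ?p x * w x) = 0"
    using sum_poly_UNIV_eq_0[of "?p * c"] card_field c(1) by simp
  then have "\<mu> * w 0 + (\<Sum>x\<in>UNIV - {0}. poly ?p x * w x) = 0"
    using sum.remove[of UNIV "0::'f" "\<lambda>x. poly ?p x * w x"]
      poly_trace_quotient_0[OF q1 assms(1), of \<mu>] by simp
  moreover have "(\<Sum>x\<in>UNIV - {0}. poly ?p x * w x) =
      (\<Sum>x\<in>UNIV - {0}. field_trace q t (\<mu> * x) * (1 / x * w x))"
    by (rule sum.cong) (use q1 in \<open>auto simp flip: poly_trace_quotient\<close>)
  \<comment> \<open>Each inner trace lies in \<open>B\<close> and leaves the outer trace as a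
    scalar, in front of a trace that vanishes by assumption.\<close>
  moreover have "field_trace q t (\<Sum>x\<in>UNIV - {0}. field_trace q t (\<mu> * x) * (1 / x * w x)) = 0"
    unfolding field_trace_sum
  proof (rule sum.neutral, rule ballI)
    fix x :: 'f assume "x \<in> UNIV - {0}"
    moreover have "field_trace q t (\<mu> * x) \<in> B"
      using field_trace_in_subfield q assms(1) card_field B by blast
    ultimately show "field_trace q t (field_trace q t (\<mu> * x) * (1 / x * w x)) = 0"
      by (subst field_trace_scale) (auto simp: traces[simplified])
  qed
  ultimately show "field_trace q t (\<mu> * w 0) = 0"
    using field_trace_add[of "\<mu> * w 0"] field_trace_zero by (metis add.right_neutral)
qed (use assms card_field in auto)

text \<open>The code is taken as a space over \<open>B\<close>, since the traces are linear over
  \<open>B\<close> only; hence the count in powers of \<open>card B\<close>.\<close>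

lemma repair_functionals_subset:
  assumes "t \<ge> 1"
  shows "\<exists>H\<subseteq>UNIV - {0 :: 'f}. card B ^ card H \<le> card (rs_code k :: ('f \<Rightarrow> 'f) set) \<and>
    (\<forall>w\<in>rs_code k. (\<forall>\<alpha>\<in>H. field_trace q t (1 / \<alpha> * w \<alpha>) = 0) \<longrightarrow>
      (\<forall>\<alpha>\<in>UNIV - {0}. field_trace q t (1 / \<alpha> * w \<alpha>) = 0))"
proof -
  let ?L = "\<lambda>\<alpha> w. field_trace q t (1 / \<alpha> * w \<alpha>) :: 'f"
  have zero: "?L \<alpha> (\<lambda>x. 0) = 0" for \<alpha>
    by (simp add: field_trace_zero)
  have add: "?L \<alpha> (\<lambda>x. v x + w x) = ?L \<alpha> v + ?L \<alpha> w" for \<alpha> v w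
    by (simp only: distrib_left field_trace_add)
  have scale: "?L \<alpha> (\<lambda>x. b * v x) = b * ?L \<alpha> v" if "b \<in> B" for \<alpha> b v
    using field_trace_scale[OF that, of "1 / \<alpha> * v \<alpha>"] by (simp add: mult_ac)
  have closed: "?L \<alpha> v \<in> B" for \<alpha> v
    by (rule field_trace_in_subfield[OF q assms card_field B])
  show ?thesis
    by (rule spanning_functionals_subset[where L = ?L, OF B(1) finite finite rs_code_zero])
      (erule (1) rs_code_add | erule rs_code_scale | rule zero add closed | erule scale)+
qed

lemma trace_repair_scheme_inverse_nodes:
  assumes "t \<ge> 1" "1 \<le> k" "k \<le> q ^ t - q ^ (t - 1)" "H \<subseteq> UNIV - {0}"
    and span: "\<forall>w\<in>rs_code k. (\<forall>\<alpha>\<in>H. field_trace q t (1 / \<alpha> * w \<alpha>) = 0) \<longrightarrow>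
      (\<forall>\<alpha>\<in>UNIV - {0}. field_trace q t (1 / \<alpha> * w \<alpha>) = 0)"
  shows "trace_repair_scheme q t k (H :: 'f set) (\<lambda>\<alpha>. 1 / \<alpha>)"
  unfolding trace_repair_scheme_def
proof (intro conjI ballI impI)
  fix v w :: "'f \<Rightarrow> 'f"
  assume v: "v \<in> rs_code k" and w: "w \<in> rs_code k"
    and eq: "\<forall>\<alpha>\<in>H. field_trace q t (1 / \<alpha> * v \<alpha>) = field_trace q t (1 / \<alpha> * w \<alpha>)"
  \<comment> \<open>The difference is written to match closure under addition and scaling.\<close>
  let ?d = "\<lambda>x. v x + (- 1) * w x"
  have d: "?d \<in> rs_code k"
    by (rule rs_code_add[OF v rs_code_scale[OF w]])
  have "field_trace q t (1 / \<alpha> * ?d \<alpha>) = 0" if "\<alpha> \<in> H" for \<alpha>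
  proof -
    have "field_trace q t (1 / \<alpha> * ?d \<alpha>) + field_trace q t (1 / \<alpha> * w \<alpha>) =
        field_trace q t (1 / \<alpha> * v \<alpha>)"
      by (subst field_trace_add[symmetric]) (simp add: algebra_simps)
    then show ?thesis
      using eq that by simp
  qed
  then have vanish: "\<forall>\<alpha>\<in>UNIV - {0}. field_trace q t (1 / \<alpha> * ?d \<alpha>) = 0"
    by (intro bspec[OF span d, THEN mp] ballI)
  have "field_trace q t (1 / \<alpha> * ?d \<alpha>) = 0" if "\<alpha> \<noteq> 0" for \<alpha>
    by (rule bspec[OF vanish]) (simp add: that)
  then have "?d 0 = 0"
    by (rule rs_code_symbol_repair[OF assms(1-3) d])
  then show "v 0 = w 0"
    by simp
qed (rule assms)

end

section \<open>From counting codewords to bandwidth\<close>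

lemma bandwidth_le:
  assumes "card B > 0" "card B ^ card H \<le> n ^ k"
  shows "bandwidth B H \<le> real k * log 2 (real n)"
proof -
  have n: "n ^ k > 0"
    using assms by (metis less_le_trans zero_less_power)
  have "real (card B) ^ card H \<le> real n ^ k"
    using assms(2) by (metis of_nat_le_iff of_nat_power)
  then have "log 2 (real (card B) ^ card H) \<le> log 2 (real n ^ k)"
    using assms(1) by (intro log_mono) auto
  then show ?thesis
    \<comment> \<open>\<open>n = 0\<close> is compatible with \<open>n ^ k > 0\<close> only for
      \<open>k = 0\<close>, where both sides of the logarithmic bound are harmless.\<close>
    using assms(1) n by (cases "n = 0"; cases "k = 0") (auto simp: bandwidth_def log_nat_power)
qed

theorem theorem11:
  fixes B :: "'f::finite_field set" and q t k n :: nat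
  assumes "primepow q" and "t \<ge> 1"
    and "is_subfield B" and "card B = q"
    and "n = q ^ t" and "card (UNIV :: 'f set) = n"
    and "1 \<le> k" and "k \<le> n - q ^ (t - 1)"
  shows "\<exists>(H :: 'f set) \<gamma>. trace_repair_scheme q t k H \<gamma> \<and>
           bandwidth B H \<le> real k * log 2 (real (card (UNIV :: 'f set)))"
proof -
  have card_field: "card (UNIV :: 'f set) = q ^ t"
    using assms(5,6) by simp
  note ctx = assms(1) card_field assms(3,4)
  obtain H :: "'f set" where H: "H \<subseteq> UNIV - {0}"
    "card B ^ card H \<le> card (rs_code k :: ('f \<Rightarrow> 'f) set)"
    "\<forall>w\<in>rs_code k. (\<forall>\<alpha>\<in>H. field_trace q t (1 / \<alpha> * w \<alpha>) = 0) \<longrightarrow>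
      (\<forall>\<alpha>\<in>UNIV - {0}. field_trace q t (1 / \<alpha> * w \<alpha>) = 0)"
    using repair_functionals_subset[OF ctx assms(2), of k] by blast
  have k: "k \<le> q ^ t - q ^ (t - 1)"
    using assms(5,8) by simp
  have "trace_repair_scheme q t k H (\<lambda>\<alpha>. 1 / \<alpha>)"
    by (rule trace_repair_scheme_inverse_nodes[OF ctx assms(2,7) k H(1,3)])
  moreover have "bandwidth B H \<le> real k * log 2 (real (card (UNIV :: 'f set)))"
  proof (rule bandwidth_le)
    show "card B > 0"
      using primepow_gt_0_nat[OF assms(1)] assms(4) by simp
    \<comment> \<open>The chosen functionals embed \<open>card B ^ card H\<close> combinations into
      the code, which has at most \<open>n ^ k\<close> words.\<close>
    show "card B ^ card H \<le> card (UNIV :: 'f set) ^ k"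
      using H(2) card_rs_code_le[OF assms(7), where 'f = 'f] by (rule order_trans)
  qed
  ultimately show ?thesis
    by blast
qed

end
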